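(* Let $E = \{r_n\}_{n \in \mathbb{N}} \subset \mathbb{N}$ with $r_1 < r_2 < \cdots$ be a set that is denser than lacunaries. Then $E$ is not an $I_0$ set.
   Context: $\mathbb{N} = \{1,2,3,\ldots\}$. A set $\{s_n\}_{n\in\mathbb{N}} \subset \mathbb{N}$ with $s_1 < s_2 < \cdots$ is called lacunary if $\inf_{n \in \mathbb{N}} s_{n+1}/s_n > 1$. A set $\{r_n\}_{n\in\mathbb{N}} \subset \mathbb{N}$ with $r_1 < r_2 < \cdots$ is called denser than lacunaries if $\lim_{n \to \infty} r_n/s_n = 0$ for every lacunary set $\{s_n\}_{n \in \mathbb{N}}$ with $s_1 < s_2 < \cdots$. An almost periodic sequence is a uniform limit of $1$-step nilsequences on $\mathbb{N}$; equivalently, it is a complex sequence $(\psi(n))_{n\in\mathbb{N}}$ that is a uniform limit (over $n \in \mathbb{N}$) of trigonometric polynomials, i.e. of sequences of the form $n \mapsto \sum_{j=1}^M c_j e^{2\pi i n \alpha_j}$ with $c_j \in \mathbb{C}$, $\alpha_j \in \mathbb{R}/\mathbb{Z}$. A set $E = \{r_n\}_{n\in\mathbb{N}} \subset \mathbb{N}$ with $r_1 < r_2 < \cdots$ is called an $I_0$ set if for every bounded sequence of complex numbers $(b(n))_{n\in\mathbb{N}}$ there exists an almost periodic sequence $(\psi(n))_{n\in\mathbb{N}}$ such that $\psi(r_n) = b(n)$ for all $n \in \mathbb{N}$. *)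

theory Defs
  imports "HOL-Analysis.Analysis" "HOL-Library.Infinite_Set"
begin

text \<open>
  The positive integers are the \<^typ>\<open>nat\<close>s in \<open>{1..}\<close>.  An infinite set \<open>S\<close> of positive integers
  is listed in increasing order by \<^const>\<open>enumerate\<close>, which counts from 0: the element
  usually written \<open>s\<^sub>n\<close> with \<open>n \<ge> 1\<close> is \<open>enumerate S (n - 1)\<close>.
\<close>

definition lacunary :: "nat set \<Rightarrow> bool" where
  "lacunary S \<longleftrightarrow> infinite S \<and> S \<subseteq> {1..} \<and>
     (INF n. real (enumerate S (Suc n)) / real (enumerate S n)) > 1"

definition denser_than_lacunaries :: "nat set \<Rightarrow> bool" where
  "denser_than_lacunaries R \<longleftrightarrow> infinite R \<and> R \<subseteq> {1..} \<and>
     (\<forall>S. lacunary S \<longrightarrow>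
        (\<lambda>n. real (enumerate R n) / real (enumerate S n)) \<longlonglongrightarrow> 0)"

definition trig_polynomial :: "(nat \<Rightarrow> complex) \<Rightarrow> bool" where
  "trig_polynomial f \<longleftrightarrow>
     (\<exists>(M::nat) (c :: nat \<Rightarrow> complex) (\<alpha> :: nat \<Rightarrow> real).
        \<forall>n. f n = (\<Sum>j=1..M. c j * exp (2 * of_real pi * \<i> * of_nat n * of_real (\<alpha> j))))"

text \<open>
  Sequences are indexed by the positive integers, so the value at 0 is left unconstrained.
\<close>

definition almost_periodic :: "(nat \<Rightarrow> complex) \<Rightarrow> bool" where
  "almost_periodic \<psi> \<longleftrightarrow>
     (\<exists>P. (\<forall>k. trig_polynomial (P k)) \<and> uniform_limit {1..} P \<psi> sequentially)"

text \<open>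
  Here the prescribed data \<open>b\<close> is indexed from 0, in step with \<^const>\<open>enumerate\<close>.
\<close>

definition I0_set :: "nat set \<Rightarrow> bool" where
  "I0_set E \<longleftrightarrow> infinite E \<and> E \<subseteq> {1..} \<and>
     (\<forall>b :: nat \<Rightarrow> complex. bounded (range b) \<longrightarrow>
        (\<exists>\<psi>. almost_periodic \<psi> \<and> (\<forall>n. \<psi> (enumerate E n) = b n)))"

end

theory Submission
  imports Defs
begin

text \<open>
  The reason is a count of degrees of freedom.  Call a trigonometric polynomial of complexity
  at most \<open>M\<close> if it has \<open>M\<close> terms and coefficients of modulus at most \<open>M\<close>.  On a stretch of
  \<open>E\<close> ending at \<open>r\<^sub>N\<close> such a polynomial is known up to a small error once its coefficients are
  known to a fixed precision and its frequencies to a precision of order \<open>1 / r\<^sub>N\<close>.  This leaves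
  at most \<open>(D r\<^sub>N)\<^sup>M\<close> possibilities, where \<open>D\<close> depends only on \<open>M\<close>.  If every pattern of signs
  \<open>\<plusminus>1\<close> on the indices \<open>m, \<dots>, N - 1\<close> could be approximated to within \<open>1/2\<close> by such a
  polynomial, then \<open>2\<^bsup>N-m\<^esup> \<le> (D r\<^sub>N)\<^sup>M\<close> (\<open>card_le_if_all_signs_approximable\<close>), so \<open>r\<^sub>N\<close> would
  grow at least like \<open>2\<^bsup>N/M\<^esup>\<close>.  A set that is denser than lacunaries grows more slowly than
  every exponential, because every exponential is dominated by a lacunary set
  (\<open>denser_than_lacunaries_subexponential\<close>).  Hence beyond every index \<open>m\<close> there is a block of
  indices carrying a sign pattern that no polynomial of complexity at most \<open>M\<close> approximates
  (\<open>exists_bad_block\<close>).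

  Lay such blocks side by side, the \<open>M\<close>-th one chosen to defeat complexity \<open>M\<close>.  The resulting
  bounded sequence of signs stays at distance more than \<open>1/2\<close> from every trigonometric
  polynomial on \<open>E\<close>, whereas an almost periodic sequence interpolating it would be uniformly
  approximable.  The side-by-side construction replaces the Baire category argument by which one
  usually extracts a uniform \<open>M\<close> from the interpolation property.
\<close>

section \<open>Trigonometric polynomials of bounded complexity\<close>

definition exp_sum :: "nat \<Rightarrow> (nat \<Rightarrow> complex) \<Rightarrow> (nat \<Rightarrow> real) \<Rightarrow> nat \<Rightarrow> complex" where
  "exp_sum M c \<alpha> n = (\<Sum>j<M. c j * cis (2 * pi * real n * \<alpha> j))"

definition bounded_exp_sums :: "nat \<Rightarrow> (nat \<Rightarrow> complex) set" where
  "bounded_exp_sums M = {exp_sum M c \<alpha> | c \<alpha>.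
     \<forall>j<M. norm (c j) \<le> real M \<and> 0 \<le> \<alpha> j \<and> \<alpha> j < 1}"

text \<open>
  One parameter can bound both the number of terms and the coefficients: pad with zero
  coefficients.  Frequencies may be reduced modulo 1, since the arguments \<open>n\<close> are integers.
\<close>
lemma trig_polynomial_in_bounded_exp_sums:
  assumes "trig_polynomial f"
  shows "\<exists>M. f \<in> bounded_exp_sums M"
proof -
  obtain m :: nat and c :: "nat \<Rightarrow> complex" and \<alpha> :: "nat \<Rightarrow> real"
    where f: "\<And>n. f n = (\<Sum>j=1..m. c j * exp (2 * of_real pi * \<i> * of_nat n * of_real (\<alpha> j)))"
    using assms unfolding trig_polynomial_def by blast
  define B where "B = (\<Sum>j=1..m. norm (c j))"
  define M where "M = max m (nat \<lceil>B\<rceil>)"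
  define d where "d j = (if j < m then c (Suc j) else 0)" for j
  define \<beta> where "\<beta> j = frac (\<alpha> (Suc j))" for j
  have phase: "exp (2 * of_real pi * \<i> * of_nat n * of_real t) = cis (2 * pi * real n * frac t)" for n t
  proof -
    have "exp (2 * of_real pi * \<i> * of_nat n * of_real t) = cis (2 * pi * real n * t)"
      by (simp add: cis_conv_exp mult_ac)
    also have "2 * pi * real n * t = 2 * pi * real n * frac t + 2 * pi * (real n * real_of_int \<lfloor>t\<rfloor>)"
      by (simp add: frac_def algebra_simps)
    also have "cis \<dots> = cis (2 * pi * real n * frac t) * cis (2 * pi * (real n * real_of_int \<lfloor>t\<rfloor>))"
      by (simp only: cis_mult)
    also have "cis (2 * pi * (real n * real_of_int \<lfloor>t\<rfloor>)) = 1"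
      by (rule cis_multiple_2pi) simp
    finally show ?thesis by simp
  qed
  have "f n = exp_sum M d \<beta> n" for n
  proof -
    have "f n = (\<Sum>j<m. d j * cis (2 * pi * real n * \<beta> j))"
      unfolding f phase by (rule sum.reindex_bij_witness[of _ Suc "\<lambda>j. j - 1"]) (auto simp: d_def \<beta>_def)
    also have "\<dots> = exp_sum M d \<beta> n"
      unfolding exp_sum_def by (rule sum.mono_neutral_left) (auto simp: M_def d_def)
    finally show ?thesis .
  qed
  moreover have "norm (d j) \<le> real M" for j
  proof (cases "j < m")
    case True
    then have "norm (c (Suc j)) \<le> B"
      unfolding B_def by (intro member_le_sum) auto
    also have "B \<le> real M"
      unfolding M_def by linarith
    finally show ?thesis using True by (simp add: d_def)
  qed (simp add: d_def)
  ultimately have "f \<in> bounded_exp_sums M"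
    unfolding bounded_exp_sums_def
    by (intro CollectI exI[of _ d] exI[of _ \<beta>]) (auto simp: \<beta>_def frac_lt_1)
  then show ?thesis ..
qed

lemma norm_cis_diff_le: "norm (cis a - cis b) \<le> \<bar>a - b\<bar>"
proof -
  have "2 * ((a - b) / 2) = a - b"
    by simp
  then have half: "cos (a - b) = 1 - 2 * (sin ((a - b) / 2))\<^sup>2"
    using cos_double_sin[of "(a - b) / 2"] by metis
  have "(norm (cis a - cis b))\<^sup>2 = 2 - 2 * cos (a - b)"
    unfolding cmod_power2
    using sin_cos_squared_add[of a] sin_cos_squared_add[of b]
    by (simp add: cos_diff power2_eq_square algebra_simps)
  also have "\<dots> = (2 * sin ((a - b) / 2))\<^sup>2"
    using half by (simp add: power_mult_distrib)
  also have "\<dots> = \<bar>2 * sin ((a - b) / 2)\<bar>\<^sup>2"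
    by simp
  also have "\<dots> \<le> \<bar>a - b\<bar>\<^sup>2"
    using abs_sin_x_le_abs_x[of "(a - b) / 2"] by (intro power_mono) (auto simp: abs_mult)
  finally show ?thesis
    by (rule power2_le_imp_le) simp
qed

lemma exp_sum_parameter_stability:
  assumes c: "\<And>j. j < M \<Longrightarrow> norm (c j) \<le> B"
    and cd: "\<And>j. j < M \<Longrightarrow> norm (c j - d j) \<le> \<delta>"
    and ab: "\<And>j. j < M \<Longrightarrow> \<bar>\<alpha> j - \<beta> j\<bar> \<le> \<eta>"
  shows "norm (exp_sum M c \<alpha> n - exp_sum M d \<beta> n) \<le> real M * (\<delta> + B * (2 * pi * real n * \<eta>))"
proof -
  have "norm (c j * cis (2 * pi * real n * \<alpha> j) - d j * cis (2 * pi * real n * \<beta> j))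
          \<le> \<delta> + B * (2 * pi * real n * \<eta>)" if j: "j < M" for j
  proof -
    let ?u = "cis (2 * pi * real n * \<alpha> j)" and ?v = "cis (2 * pi * real n * \<beta> j)"
    have "norm (?u - ?v) \<le> \<bar>2 * pi * real n * \<alpha> j - 2 * pi * real n * \<beta> j\<bar>"
      by (rule norm_cis_diff_le)
    also have "\<dots> = 2 * pi * real n * \<bar>\<alpha> j - \<beta> j\<bar>"
      by (simp add: abs_mult flip: right_diff_distrib)
    also have "\<dots> \<le> 2 * pi * real n * \<eta>"
      using ab[OF j] by (intro mult_left_mono) auto
    finally have uv: "norm (?u - ?v) \<le> 2 * pi * real n * \<eta>" .
    have "c j * ?u - d j * ?v = (c j - d j) * ?v + c j * (?u - ?v)"
      by (simp add: algebra_simps)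
    then have "norm (c j * ?u - d j * ?v) \<le> norm (c j - d j) + norm (c j) * norm (?u - ?v)"
      using norm_triangle_ineq[of "(c j - d j) * ?v" "c j * (?u - ?v)"] by (simp add: norm_mult)
    also have "norm (c j) * norm (?u - ?v) \<le> B * (2 * pi * real n * \<eta>)"
      using c[OF j] uv norm_ge_zero[of "c j"] by (intro mult_mono norm_ge_zero) linarith+
    finally show ?thesis using cd[OF j] by linarith
  qed
  then show ?thesis
    unfolding exp_sum_def sum_subtractf[symmetric]
    using sum_norm_le[of "{..<M}" _ "\<lambda>_. \<delta> + B * (2 * pi * real n * \<eta>)"] by fastforce
qed

section \<open>Counting sign patterns\<close>

definition sign_value :: "bool \<Rightarrow> complex" where
  "sign_value s = (if s then 1 else -1)"

text \<open>
  The grid for the coefficients has mesh \<open>1 / grid_scale M\<close> and the one for the frequencies has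
  mesh \<open>1 / (grid_scale M * R)\<close>, where \<open>R\<close> bounds the arguments.  The scale is chosen so that
  rounding changes a sum of complexity at most \<open>M\<close> by less than 1: the coefficients contribute at
  most \<open>2 M / grid_scale M\<close> and the frequencies at most \<open>2 \<pi> M\<^sup>2 / grid_scale M\<close>.
\<close>
definition grid_scale :: "nat \<Rightarrow> nat" where
  "grid_scale M = 16 * (M + 1)\<^sup>2"

text \<open>
  One term has \<open>grid_const M * R\<close> possible grid cells: two factors for the real and imaginary part
  of a coefficient in the disc of radius \<open>M\<close>, and one, with \<open>R\<close>, for a frequency in \<open>[0, 1)\<close>.
\<close>
definition grid_const :: "nat \<Rightarrow> nat" where
  "grid_const M = (2 * (grid_scale M * M) + 1)\<^sup>2 * grid_scale M"

lemma floor_eq_imp_close: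
  fixes x y K :: real
  assumes "K > 0" "\<lfloor>K * x\<rfloor> = \<lfloor>K * y\<rfloor>"
  shows "\<bar>x - y\<bar> \<le> 1 / K"
proof -
  have "\<bar>K * x - K * y\<bar> \<le> 1"
    using assms(2) by linarith
  then have "K * \<bar>x - y\<bar> \<le> 1"
    using assms(1) by (simp add: abs_mult flip: right_diff_distrib)
  then show ?thesis
    using assms(1) by (simp add: field_simps)
qed

lemma same_grid_cell_imp_close:
  assumes R: "R > 0" "n \<le> R"
    and c: "\<And>j. j < M \<Longrightarrow> norm (c j) \<le> real M"
    and re: "\<And>j. j < M \<Longrightarrow> \<lfloor>real (grid_scale M) * Re (c j)\<rfloor> = \<lfloor>real (grid_scale M) * Re (d j)\<rfloor>"
    and im: "\<And>j. j < M \<Longrightarrow> \<lfloor>real (grid_scale M) * Im (c j)\<rfloor> = \<lfloor>real (grid_scale M) * Im (d j)\<rfloor>"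
    and ph: "\<And>j. j < M \<Longrightarrow> \<lfloor>real (grid_scale M * R) * \<alpha> j\<rfloor> = \<lfloor>real (grid_scale M * R) * \<beta> j\<rfloor>"
  shows "norm (exp_sum M c \<alpha> n - exp_sum M d \<beta> n) < 1"
proof -
  define K where "K = real (grid_scale M)"
  have K: "K = 16 * (real M + 1)\<^sup>2" "K > 0"
    by (simp_all add: K_def grid_scale_def)
  have "norm (c j - d j) \<le> 2 / K" if "j < M" for j
    using cmod_le[of "c j - d j"] floor_eq_imp_close[OF K(2), of "Re (c j)" "Re (d j)"]
      floor_eq_imp_close[OF K(2), of "Im (c j)" "Im (d j)"] re[OF that] im[OF that]
    by (auto simp: K_def)
  moreover have "\<bar>\<alpha> j - \<beta> j\<bar> \<le> 1 / (K * R)" if "j < M" for j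
    using floor_eq_imp_close[of "K * R" "\<alpha> j" "\<beta> j"] ph[OF that] K R by (simp add: K_def)
  ultimately have "norm (exp_sum M c \<alpha> n - exp_sum M d \<beta> n)
      \<le> real M * (2 / K + real M * (2 * pi * real n * (1 / (K * R))))"
    using c by (intro exp_sum_parameter_stability)
  also have "\<dots> = (2 * real M + 2 * pi * (real M)\<^sup>2 * (real n / real R)) / K"
    using K(2) R by (simp add: field_simps power2_eq_square)
  also have "\<dots> \<le> (2 * real M + 2 * 4 * (real M)\<^sup>2 * 1) / K"
    using K(2) R pi_less_4 by (intro divide_right_mono add_left_mono mult_mono) auto
  also have "\<dots> < 1"
    using K by (simp add: power2_eq_square algebra_simps add_pos_nonneg)
  finally show ?thesis .
qed

text \<open>
  Choose an approximating sum for each subset of \<open>I\<close>, read as a sign pattern, and round its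
  parameters.  Two sums in the same cell differ by less than 1, and each is within \<open>1/2\<close> of its
  pattern, so the patterns differ by less than 2 everywhere and must agree.  Rounding is therefore
  injective on patterns, and there are no more patterns than cells.
\<close>
lemma card_le_if_all_signs_approximable:
  fixes I :: "'a set"
  assumes I: "finite I" and R: "R > 0" "\<And>n. n \<in> I \<Longrightarrow> r n \<le> R"
    and approx: "\<And>p. \<exists>f\<in>bounded_exp_sums M. \<forall>n\<in>I. norm (f (r n) - sign_value (p n)) \<le> 1/2"
  shows "2 ^ card I \<le> (grid_const M * R) ^ M"
proof -
  define K where "K = grid_scale M"
  have "\<forall>A. \<exists>c \<alpha>. (\<forall>j<M. norm (c j) \<le> real M \<and> 0 \<le> \<alpha> j \<and> \<alpha> j < 1) \<and>
          (\<forall>n\<in>I. norm (exp_sum M c \<alpha> (r n) - sign_value (n \<in> A)) \<le> 1/2)"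
  proof
    fix A
    show "\<exists>c \<alpha>. (\<forall>j<M. norm (c j) \<le> real M \<and> 0 \<le> \<alpha> j \<and> \<alpha> j < 1) \<and>
          (\<forall>n\<in>I. norm (exp_sum M c \<alpha> (r n) - sign_value (n \<in> A)) \<le> 1/2)"
      using approx[of "\<lambda>n. n \<in> A"] unfolding bounded_exp_sums_def by auto
  qed
  then obtain c :: "'a set \<Rightarrow> nat \<Rightarrow> complex" and \<alpha> :: "'a set \<Rightarrow> nat \<Rightarrow> real"
    where bnd: "\<And>A j. j < M \<Longrightarrow> norm (c A j) \<le> real M \<and> 0 \<le> \<alpha> A j \<and> \<alpha> A j < 1"
      and app: "\<And>A n. n \<in> I \<Longrightarrow> norm (exp_sum M (c A) (\<alpha> A) (r n) - sign_value (n \<in> A)) \<le> 1/2"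
    by metis
  define code where "code A = (\<lambda>j\<in>{..<M}.
      (\<lfloor>real K * Re (c A j)\<rfloor>, \<lfloor>real K * Im (c A j)\<rfloor>, \<lfloor>real (K * R) * \<alpha> A j\<rfloor>))" for A
  define cells :: "(int \<times> int \<times> int) set"
    where "cells = {- int (K * M)..int (K * M)} \<times> {- int (K * M)..int (K * M)} \<times> {0..<int (K * R)}"
  have card_cells: "card cells = grid_const M * R"
    by (simp add: cells_def grid_const_def K_def card_cartesian_product power2_eq_square algebra_simps
        nat_add_distrib nat_mult_distrib)
  have "inj_on code (Pow I)"
  proof (rule inj_onI)
    fix A B assume AB: "A \<in> Pow I" "B \<in> Pow I" and eq: "code A = code B"
    have "n \<in> A \<longleftrightarrow> n \<in> B" if n: "n \<in> I" for n
    proof (rule ccontr)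
      assume neq: "(n \<in> A) \<noteq> (n \<in> B)"
      have cell: "\<lfloor>real K * Re (c A j)\<rfloor> = \<lfloor>real K * Re (c B j)\<rfloor> \<and>
             \<lfloor>real K * Im (c A j)\<rfloor> = \<lfloor>real K * Im (c B j)\<rfloor> \<and>
             \<lfloor>real (K * R) * \<alpha> A j\<rfloor> = \<lfloor>real (K * R) * \<alpha> B j\<rfloor>" if "j < M" for j
        using fun_cong[OF eq, of j] that by (simp add: code_def)
      have "norm (exp_sum M (c A) (\<alpha> A) (r n) - exp_sum M (c B) (\<alpha> B) (r n)) < 1"
        using same_grid_cell_imp_close[OF R(1) R(2)[OF n], where M = M and c = "c A" and d = "c B" and \<alpha> = "\<alpha> A" and \<beta> = "\<alpha> B"]
          bnd cell unfolding K_def by blast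
      moreover have "norm (sign_value (n \<in> A) - sign_value (n \<in> B)) = 2"
        using neq by (auto simp: sign_value_def)
      moreover have "norm (sign_value (n \<in> A) - sign_value (n \<in> B)) \<le>
          norm (exp_sum M (c A) (\<alpha> A) (r n) - sign_value (n \<in> A)) +
          norm (exp_sum M (c A) (\<alpha> A) (r n) - exp_sum M (c B) (\<alpha> B) (r n)) +
          norm (exp_sum M (c B) (\<alpha> B) (r n) - sign_value (n \<in> B))"
        by norm
      ultimately show False
        using app[OF n, of A] app[OF n, of B] by linarith
    qed
    then show "A = B" using AB by blast
  qed
  moreover have "code ` Pow I \<subseteq> {..<M} \<rightarrow>\<^sub>E cells"
  proof -
    have "code A \<in> {..<M} \<rightarrow>\<^sub>E cells" for A
    proof -
      have coef: "\<lfloor>real K * x\<rfloor> \<in> {- int (K * M)..int (K * M)}" if "\<bar>x\<bar> \<le> real M" for x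
      proof -
        have "\<bar>real K * x\<bar> \<le> real (K * M)"
          using that by (simp add: abs_mult mult_left_mono)
        then show ?thesis
          by (auto simp: le_floor_iff floor_le_iff)
      qed
      have phase: "\<lfloor>real (K * R) * x\<rfloor> \<in> {0..<int (K * R)}" if "0 \<le> x" "x < 1" for x
      proof -
        have "real (K * R) * x < real (K * R) * 1"
          using that R by (intro mult_strict_left_mono) (auto simp: K_def grid_scale_def)
        then have "\<lfloor>real (K * R) * x\<rfloor> < int (K * R)"
          by (simp only: floor_less_iff of_int_of_nat_eq mult_1_right)
        moreover have "0 \<le> \<lfloor>real (K * R) * x\<rfloor>"
          using that by simp
        ultimately show ?thesis by simp
      qed
      show ?thesis
        unfolding code_def cells_def
        using bnd[of _ A] abs_Re_le_cmod[of "c A _"] abs_Im_le_cmod[of "c A _"]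
        by (intro restrict_PiE[THEN iffD2] PiE_I Pi_I SigmaI restrict_extensional coef phase) (force dest: order_trans)+
    qed
    then show ?thesis by blast
  qed
  moreover have "finite ({..<M} \<rightarrow>\<^sub>E cells)"
    by (intro finite_PiE) (auto simp: cells_def)
  ultimately have "card (Pow I) \<le> card ({..<M} \<rightarrow>\<^sub>E cells)"
    by (rule card_inj_on_le)
  then show ?thesis
    using I by (simp add: card_Pow card_PiE card_cells)
qed

section \<open>Sets denser than lacunary sets grow subexponentially\<close>

lemma enumerate_range_strict_mono:
  fixes s :: "nat \<Rightarrow> nat"
  assumes "strict_mono s"
  shows "enumerate (range s) n = s n"
proof -
  have inf: "infinite (range s)"
    using assms by (simp add: range_inj_infinite strict_mono_imp_inj_on)
  show ?thesis
  proof (induction n)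
    case 0
    show ?case
      unfolding enumerate_0
      by (rule Least_equality) (auto simp: strict_mono_less_eq[OF assms])
  next
    case (Suc n)
    show ?case
      unfolding enumerate_Suc''[OF inf] Suc
      by (rule Least_equality) (auto simp: strict_mono_less[OF assms] strict_mono_less_eq[OF assms])
  qed
qed

text \<open>
  The set is \<open>{\<lceil>A q\<^sup>n\<rceil>}\<close>.  Rounding up costs at most a factor \<open>(A + 1) / A\<close> in a quotient of
  consecutive elements, so \<open>A > 1 / (q - 1)\<close> keeps these quotients bounded below by a constant
  exceeding 1.
\<close>
lemma exists_lacunary_of_growth:
  fixes q :: real
  assumes q: "q > 1"
  shows "\<exists>S C. lacunary S \<and> C > 0 \<and> (\<forall>n. real (enumerate S n) \<le> C * q ^ n)"
proof -
  define A where "A = real (nat \<lceil>1 / (q - 1)\<rceil> + 1)"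
  have A: "A \<ge> 1" "A > 1 / (q - 1)"
    unfolding A_def by linarith+
  then have Aq: "A * (q - 1) > 1"
    using q by (simp add: field_simps)
  define s where "s n = nat \<lceil>A * q ^ n\<rceil>" for n
  have qn: "q ^ n \<ge> 1" for n
    using q by simp
  have pos: "A * q ^ n \<ge> 1" for n
    using mult_mono[OF A(1) qn[of n]] A(1) by simp
  have s_ge: "real (s n) \<ge> A * q ^ n" for n
    unfolding s_def by linarith
  have s_le: "real (s n) \<le> (A + 1) * q ^ n" for n
  proof -
    have "real (s n) \<le> A * q ^ n + 1"
      unfolding s_def using pos[of n] by linarith
    then show ?thesis using qn[of n] by (simp add: algebra_simps)
  qed
  have s_pos: "s n \<ge> 1" for n
    using s_ge[of n] pos[of n] by linarith
  define \<rho> where "\<rho> = q * A / (A + 1)"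
  have \<rho>: "\<rho> > 1"
    unfolding \<rho>_def using Aq A by (simp add: field_simps)
  have ratio: "real (s (Suc n)) / real (s n) \<ge> \<rho>" for n
  proof -
    have "\<rho> * real (s n) \<le> \<rho> * ((A + 1) * q ^ n)"
      using s_le[of n] \<rho> by (intro mult_left_mono) auto
    also have "\<dots> = A * q ^ Suc n"
      unfolding \<rho>_def using A by (simp add: field_simps)
    also have "\<dots> \<le> real (s (Suc n))" by (rule s_ge)
    finally show ?thesis using s_pos[of n] by (simp add: field_simps)
  qed
  have "s n < s (Suc n)" for n
  proof -
    have "1 < real (s (Suc n)) / real (s n)"
      using ratio[of n] \<rho> by linarith
    then show ?thesis using s_pos[of n] by (simp add: field_simps)
  qed
  then have mono: "strict_mono s"
    by (simp add: strict_mono_Suc_iff)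
  have "\<rho> \<le> (INF n. real (s (Suc n)) / real (s n))"
    by (rule cINF_greatest) (auto intro: ratio)
  then have "lacunary (range s)"
    unfolding lacunary_def enumerate_range_strict_mono[OF mono]
    using \<rho> s_pos mono by (auto simp: range_inj_infinite strict_mono_imp_inj_on)
  moreover have "real (enumerate (range s) n) \<le> (A + 1) * q ^ n" for n
    unfolding enumerate_range_strict_mono[OF mono] by (rule s_le)
  moreover have "A + 1 > 0" using A by linarith
  ultimately show ?thesis by blast
qed

lemma denser_than_lacunaries_subexponential:
  assumes "denser_than_lacunaries E" and q: "q > 1" and \<epsilon>: "\<epsilon> > 0"
  shows "eventually (\<lambda>n. real (enumerate E n) < \<epsilon> * q ^ n) sequentially"
proof -
  obtain S C where S: "lacunary S" and C: "C > 0"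
    and le: "\<And>n. real (enumerate S n) \<le> C * q ^ n"
    using exists_lacunary_of_growth[OF q] by blast
  have "(\<lambda>n. real (enumerate E n) / real (enumerate S n)) \<longlonglongrightarrow> 0"
    using assms(1) S unfolding denser_than_lacunaries_def by blast
  then have "eventually (\<lambda>n. real (enumerate E n) / real (enumerate S n) < \<epsilon> / C) sequentially"
    using \<epsilon> C by (intro order_tendstoD(2)) auto
  then show ?thesis
  proof eventually_elim
    case (elim n)
    have "enumerate S n \<in> S"
      using S unfolding lacunary_def by (blast intro: enumerate_in_set)
    then have "real (enumerate S n) > 0"
      using S unfolding lacunary_def by fastforce
    then have "real (enumerate E n) < \<epsilon> / C * real (enumerate S n)"
      using elim by (simp add: pos_divide_less_eq)
    also have "\<dots> \<le> \<epsilon> / C * (C * q ^ n)"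
      using le[of n] \<epsilon> C by (intro mult_left_mono) auto
    finally show ?case using C by simp
  qed
qed

section \<open>Bad blocks and their concatenation\<close>

text \<open>
  If every pattern on every block starting at \<open>m\<close> were approximable, the count would force
  \<open>r\<^sub>N\<close> to be at least a constant multiple of \<open>q\<^sup>N\<close> with \<open>q = 2\<^bsup>1/M\<^esup> > 1\<close>.
\<close>
lemma exists_bad_block:
  assumes E: "denser_than_lacunaries E"
  shows "\<exists>N p. N \<ge> m \<and> (\<forall>f\<in>bounded_exp_sums M. \<exists>n\<in>{m..<N}.
           norm (f (enumerate E n) - sign_value (p n)) > 1/2)"
proof (rule ccontr)
  assume "\<not> ?thesis"
  then have approx: "\<exists>f\<in>bounded_exp_sums M. \<forall>n\<in>{m..<N}. norm (f (enumerate E n) - sign_value (p n)) \<le> 1/2"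
    if "N \<ge> m" for N p
    using that by (meson not_less)
  have infE: "infinite E" and Epos: "E \<subseteq> {1..}"
    using E unfolding denser_than_lacunaries_def by auto
  have count: "2 ^ (N - m) \<le> (grid_const M * enumerate E N) ^ M" if "N \<ge> m" for N
  proof -
    have "enumerate E N > 0"
      using enumerate_in_set[OF infE, of N] Epos by fastforce
    then have "2 ^ card {m..<N} \<le> (grid_const M * enumerate E N) ^ M"
      using approx[OF that] infE
      by (intro card_le_if_all_signs_approximable[where r = "enumerate E"]) auto
    then show ?thesis by simp
  qed
  show False
  proof (cases "M = 0")
    \<comment> \<open>There is no \<open>M\<close>-th root for \<open>M = 0\<close>, but then a single index already refutes the count.\<close>
    case True
    then show False using count[of "Suc m"] by simp
  next
    case False
    define q where "q = root M 2"
    define D where "D = real (grid_const M)"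
    have q: "q > 1" "q ^ M = 2"
      using False by (simp_all add: q_def)
    have "grid_const M > 0"
      by (simp add: grid_const_def grid_scale_def)
    then have D: "D > 0"
      by (simp add: D_def)
    have "eventually (\<lambda>N. real (enumerate E N) < 1 / (D * q ^ m) * q ^ N) sequentially"
      using q D by (intro denser_than_lacunaries_subexponential[OF E]) auto
    then have "eventually (\<lambda>N. real (enumerate E N) < 1 / (D * q ^ m) * q ^ N \<and> N \<ge> m) sequentially"
      using eventually_ge_at_top by (rule eventually_conj)
    then obtain N where N: "real (enumerate E N) < 1 / (D * q ^ m) * q ^ N" "N \<ge> m"
      by (auto dest: eventually_happens)
    have "D * real (enumerate E N) < q ^ (N - m)"
      using N q D by (simp add: field_simps power_diff)
    then have "(D * real (enumerate E N)) ^ M < (q ^ (N - m)) ^ M"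
      using D False by (intro power_strict_mono) auto
    also have "\<dots> = 2 ^ (N - m)"
      using q by (metis power_mult mult.commute)
    also have "\<dots> \<le> (D * real (enumerate E N)) ^ M"
      using of_nat_mono[OF count[OF N(2)], where 'a = real] by (simp add: D_def)
    finally show False by simp
  qed
qed

text \<open>
  The block for \<open>k\<close> is made to start where the one for \<open>k - 1\<close> ends.  This needs a block
  \<open>{m..<N k m}\<close> to be available from every possible starting index \<open>m\<close>, which is why patterns
  are indexed by \<open>m\<close> as well.
\<close>
lemma concatenate_blocks:
  fixes N :: "nat \<Rightarrow> nat \<Rightarrow> nat" and p :: "nat \<Rightarrow> nat \<Rightarrow> nat \<Rightarrow> 'a"
  assumes N: "\<And>k m. N k m \<ge> m"
  shows "\<exists>b. \<forall>k. \<exists>m. \<forall>n\<in>{m..<N k m}. b n = p k m n"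
proof -
  \<comment> \<open>The block for \<open>k\<close> is \<open>{s k..<s (Suc k)}\<close>; it may be empty.\<close>
  define s where "s = rec_nat 0 N"
  have s_Suc: "s (Suc k) = N k (s k)" for k
    by (simp add: s_def)
  have s_mono: "s i \<le> s j" if "i \<le> j" for i j
    using that by (rule lift_Suc_mono_le[rotated]) (simp add: s_Suc N)
  define k\<^sub>0 where "k\<^sub>0 n = (LEAST k. n < s (Suc k))" for n
  have "k\<^sub>0 n = k" if n: "n \<in> {s k..<s (Suc k)}" for n k
    unfolding k\<^sub>0_def
  proof (rule Least_equality)
    show "n < s (Suc k)" using n by simp
    show "k \<le> i" if "n < s (Suc i)" for i
      using s_mono[of "Suc i" k] n that by (cases "k \<le> i") auto
  qed
  then have "\<forall>n\<in>{s k..<N k (s k)}. p (k\<^sub>0 n) (s (k\<^sub>0 n)) n = p k (s k) n" for k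
    by (simp add: s_Suc)
  then show ?thesis
    by (intro exI[of _ "\<lambda>n. p (k\<^sub>0 n) (s (k\<^sub>0 n)) n"]) blast
qed

theorem theorem1p2:
  fixes E :: "nat set"
  assumes "infinite E" and "E \<subseteq> {1..}"
    and "denser_than_lacunaries E"
  shows "\<not> I0_set E"
proof
  assume I0: "I0_set E"
  have "\<forall>M m. \<exists>N p. N \<ge> m \<and> (\<forall>f\<in>bounded_exp_sums M. \<exists>n\<in>{m..<N}.
      norm (f (enumerate E n) - sign_value (p n)) > 1/2)"
    using exists_bad_block[OF assms(3)] by blast
  \<comment> \<open>The block lengths and patterns have to be chosen as functions of \<open>M\<close> and \<open>m\<close>, before it is
    known where each block will start.\<close>
  then obtain N p where Np: "\<forall>M m. N M m \<ge> m \<and> (\<forall>f\<in>bounded_exp_sums M. \<exists>n\<in>{m..<N M m}.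
      norm (f (enumerate E n) - sign_value (p M m n)) > 1/2)"
    unfolding choice_iff by blast
  then have N: "N M m \<ge> m" for M m
    by blast
  obtain b where b: "\<And>M. \<exists>m. \<forall>n\<in>{m..<N M m}. b n = p M m n"
    using concatenate_blocks[of N p] N by blast
  have "bounded (range (\<lambda>n. sign_value (b n)))"
    by (rule boundedI[of _ 1]) (auto simp: sign_value_def)
  then obtain \<psi> where ap: "almost_periodic \<psi>" and \<psi>: "\<And>n. \<psi> (enumerate E n) = sign_value (b n)"
    using I0 unfolding I0_set_def by blast
  obtain P where P: "\<And>k. trig_polynomial (P k)" and lim: "uniform_limit {1..} P \<psi> sequentially"
    using ap unfolding almost_periodic_def by blast
  have "eventually (\<lambda>k. \<forall>n\<in>{1..}. dist (P k n) (\<psi> n) < 1/2) sequentially"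
    using lim by (rule uniform_limitD) simp
  from eventually_happens'[OF sequentially_bot this]
  obtain k where k: "\<And>n. n \<ge> 1 \<Longrightarrow> dist (P k n) (\<psi> n) < 1/2"
    by auto
  obtain M where M: "P k \<in> bounded_exp_sums M"
    using trig_polynomial_in_bounded_exp_sums[OF P] by blast
  obtain m where m: "\<And>n. n \<in> {m..<N M m} \<Longrightarrow> b n = p M m n"
    using b by blast
  obtain n where n: "n \<in> {m..<N M m}"
    and far: "norm (P k (enumerate E n) - sign_value (p M m n)) > 1/2"
    using Np M by blast
  have "enumerate E n \<ge> 1"
    using enumerate_in_set[OF assms(1)] assms(2) by auto
  from k[OF this] show False
    using far m[OF n] by (simp add: \<psi> dist_norm)
qed

end
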